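(* Let $A\in\mathbb{R}^{m\times n}$ and $b\in\mathbb{R}^m$ with $m>n$, and let $L\in\mathbb{R}^{n\times k}$ with $k\le n$. Let $\sigma_1\ge\dots\ge\sigma_{n+1}$ be the singular values of $[A,b]$ and $\sigma'_1\ge\dots\ge\sigma'_n$ those of $A$, and assume the genericity condition $\sigma'_n>\sigma_{n+1}$. Let $V\in\mathbb{R}^{(n+1)\times(n+1)}$ and $V'\in\mathbb{R}^{n\times n}$ be the (orthogonal) matrices whose columns are the right singular vectors of respectively $[A,b]$ and $A$ associated with the singular values $(\sigma_1,\dots,\sigma_{n+1})$ and $(\sigma'_1,\dots,\sigma'_n)$. Let $x$ be the total least squares solution. Then the condition number $K(L,A,b)$ of $L^Tx$ (defined in the context) is $$K(L,A,b)=(1+\|x\|_2^2)^{1/2}\left\|L^TV'D'\begin{bmatrix}V'^T, & 0_{n,1}\end{bmatrix}V\begin{bmatrix}D, & 0_{n,1}\end{bmatrix}^T\right\|_2,$$ where $$D'=\mathrm{diag}\left((\sigma_1'^2-\sigma_{n+1}^2)^{-1},\dots,(\sigma_n'^2-\sigma_{n+1}^2)^{-1}\right),\qquad D=\mathrm{diag}\left((\sigma_1^2+\sigma_{n+1}^2)^{1/2},\dots,(\sigma_n^2+\sigma_{n+1}^2)^{1/2}\right).$$ When $L$ is the identity matrix $I_n$, the condition number reduces to $$K(L,A,b)=(1+\|x\|_2^2)^{1/2}\left\|D'\begin{bmatrix}V'^T, & 0_{n,1}\end{bmatrix}V\begin{bmatrix}D, & 0_{n,1}\end{bmatrix}^T\right\|_2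 .$$
   Context: $0_{n,1}$ denotes the zero column vector of length $n$, so $[V'^T,0_{n,1}]$ and $[D,0_{n,1}]$ are $n\times(n+1)$ matrices. The total least squares (TLS) problem is $\min_{E,\epsilon}\|(E,\epsilon)\|_F$ subject to $(A+E)x=b+\epsilon$; under the genericity condition $\sigma'_n>\sigma_{n+1}$ its solution $x$ exists, is unique, and equals $x=(A^TA-\lambda_{n+1}I_n)^{-1}A^Tb$, where $\lambda_{n+1}=\sigma_{n+1}^2$. The mapping $g$ is $g(A,b)=L^Tx=L^T(A^TA-\lambda_{n+1}I_n)^{-1}A^Tb\in\mathbb{R}^k$, where $\lambda_{n+1}=\lambda_{n+1}(A,b)$ is regarded as a function of $(A,b)$ (the smallest eigenvalue of $[A,b]^T[A,b]$); $L$ is fixed. The genericity condition is open, so $g$ is defined in a neighborhood of $(A,b)$ in $\mathbb{R}^{m\times n}\times\mathbb{R}^m$, and it is Fréchet differentiable there. Data are measured with the norm $\|(\Delta A,\Delta b)\|_F=\sqrt{\|\Delta A\|_F^2+\|\Delta b\|_2^2}$, and the (absolute) condition number is $$K(L,A,b)=\max_{(\Delta A,\Delta b)\neq 0}\frac{\|g'(A,b).(\Delta A,\Delta b)\|_2}{\|(\Delta A,\Delta b)\|_F}.$$ For matrices, $\|\cdot\|_2$ is the spectral norm. *)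

theory Defs
  imports "HOL-Analysis.Analysis"
begin

text \<open>
  An m x n matrix is an element of \<open>real^'n^'m\<close>. The index type of the n+1 columns of
  \<open>[M, v]\<close> is \<open>'n option\<close>, where \<open>None\<close> stands for the last position n+1.
\<close>

definition append_col :: "real^'n^'m \<Rightarrow> real^'m \<Rightarrow> real^('n option)^'m" where
  "append_col M v = (\<chi> i j. case j of Some j' \<Rightarrow> M $ i $ j' | None \<Rightarrow> v $ i)"

definition diag_mat :: "('n \<Rightarrow> real) \<Rightarrow> real^'n^'n" where
  "diag_mat d = (\<chi> i j. if i = j then d i else 0)"

definition spectral_norm :: "real^'n^'m \<Rightarrow> real" where
  "spectral_norm M = onorm ((*v) M)"

text \<open>
  Thin singular value decomposition \<open>M = U diag(s) V\<^sup>T\<close>, for matrices with at least as many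
  rows as columns: \<open>s\<close> lists all singular values of \<open>M\<close>, and column \<open>j\<close> of \<open>V\<close> is a right
  singular vector associated with \<open>s j\<close>. No ordering of \<open>s\<close> is required here.
\<close>

definition thin_svd :: "real^'n^'m \<Rightarrow> real^'n^'m \<Rightarrow> ('n \<Rightarrow> real) \<Rightarrow> real^'n^'n \<Rightarrow> bool" where
  "thin_svd M U s V \<longleftrightarrow>
     transpose U ** U = mat 1 \<and> orthogonal_matrix V \<and> (\<forall>j. 0 \<le> s j) \<and>
     M = U ** diag_mat s ** transpose V"

definition right_singular_system :: "real^'n^'m \<Rightarrow> ('n \<Rightarrow> real) \<Rightarrow> real^'n^'n \<Rightarrow> bool" where
  "right_singular_system M s V \<longleftrightarrow> (\<exists>U. thin_svd M U s V)"

text \<open>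
  On \<open>real^'n^'m\<close> the library norm is the Frobenius norm, and on pairs it is
  \<open>norm (E, e) = sqrt ((norm E)\<^sup>2 + (norm e)\<^sup>2)\<close>, so \<open>norm (E, e)\<close> is the Frobenius norm
  of \<open>(E, e)\<close>.
\<close>

definition is_tls_solution :: "real^'n^'m \<Rightarrow> real^'m \<Rightarrow> real^'n \<Rightarrow> bool" where
  "is_tls_solution A b x \<longleftrightarrow>
     (\<exists>E e. (A + E) *v x = b + e \<and>
        (\<forall>E' e' x'. (A + E') *v x' = b + e' \<longrightarrow> norm (E, e) \<le> norm (E', e')))"

definition tls_solution :: "real^'n^'m \<Rightarrow> real^'m \<Rightarrow> real^'n" where
  "tls_solution A b = (THE x. is_tls_solution A b x)"

definition tls_map :: "real^'k^'n \<Rightarrow> (real^'n^'m) \<times> (real^'m) \<Rightarrow> real^'k" where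
  "tls_map L = (\<lambda>(A, b). transpose L *v tls_solution A b)"

text \<open>\<open>GREATEST\<close> expresses a maximum that is attained.\<close>

definition tls_cond :: "real^'k^'n \<Rightarrow> real^'n^'m \<Rightarrow> real^'m \<Rightarrow> real" where
  "tls_cond L A b =
     (GREATEST r. \<exists>d. d \<noteq> 0 \<and>
        r = norm (frechet_derivative (tls_map L) (at (A, b)) d) / norm d)"

end

theory Submission
  imports Defs
begin

text \<open>
  Genericity says that the smallest singular value of \<open>[A, b]\<close> is below that of \<open>A\<close>. Since smallest singular
  values are 1-Lipschitz, this is an open condition, and under it the TLS solution is the unique \<open>x\<close>
  for which \<open>(x, -1)\<close> minimises the Rayleigh quotient of \<open>[A, b]\<^sup>T[A, b]\<close>, with minimum \<open>\<lambda>\<close>.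
  Subtracting the stationarity equations of two data sets expresses the increments of \<open>\<lambda>\<close> and \<open>x\<close> as
  products in which one factor is linear in the data increment, so continuity of \<open>x\<close> already gives
  differentiability, with derivative
  \<open>R (2 (r \<bullet> e) / (1 + \<parallel>x\<parallel>\<^sup>2) x - \<Delta>A\<^sup>T r - A\<^sup>T e)\<close> for \<open>r = A x - b\<close>, \<open>e = \<Delta>A x - \<Delta>b\<close> and
  \<open>R\<close> the inverse of \<open>A\<^sup>T A - \<lambda> I\<close>. The squared norm of the adjoint of the part behind \<open>R\<close> at \<open>u\<close> is
  \<open>(1 + \<parallel>x\<parallel>\<^sup>2) (\<parallel>A u\<parallel>\<^sup>2 + \<lambda> \<parallel>u\<parallel>\<^sup>2 - 2 \<lambda> (x \<bullet> u)\<^sup>2 / (1 + \<parallel>x\<parallel>\<^sup>2))\<close>; because the last right singular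
  vector of \<open>[A, b]\<close> is proportional to \<open>(x, -1)\<close>, the second factor is \<open>\<parallel>M\<^sup>T u\<parallel>\<^sup>2\<close> with
  \<open>M = [I, 0] V [D, 0]\<^sup>T\<close>, and adjoint maps have equal operator norms.
\<close>

text \<open>As a simp rule it turns \<open>transpose M *v u\<close> into \<open>u v* M\<close>,
  which would hide the adjoint structure used throughout.\<close>

declare transpose_matrix_vector [simp del]

section \<open>Matrices and the Frobenius norm\<close>

text \<open>Cauchy-Schwarz in each row; the Frobenius norm is the Euclidean norm of the vector of
  row norms.\<close>

lemma norm_matrix_vector_mult_le:
  fixes M :: "real^'c^'r"
  shows "norm (M *v v) \<le> norm M * norm v"
proof -
  have "norm (M *v v) \<le> L2_set (\<lambda>i. norm v * norm (M $ i)) UNIV"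
    unfolding norm_vec_def[of "M *v v"]
    by (rule L2_set_mono) (auto simp: matrix_mult_dot Cauchy_Schwarz_ineq2 mult.commute[of "norm v"])
  also have "\<dots> = norm M * norm v"
    by (simp add: L2_set_right_distrib[symmetric] norm_vec_def[of M] mult.commute)
  finally show ?thesis .
qed

lemma bounded_bilinear_matrix_vector_mult:
  "bounded_bilinear ((*v) :: real^'c^'r \<Rightarrow> _)"
  by (rule bounded_bilinear.intro)
    (auto simp: matrix_vector_right_distrib matrix_vector_mult_add_rdistrib matrix_vector_mult_scaleR
      scaleR_matrix_vector_assoc intro!: exI[of _ 1] norm_matrix_vector_mult_le)

lemma norm_transpose: "norm (transpose M) = norm (M :: real^'c^'r)"
proof -
  have "inner (transpose M) (transpose M) = inner M M"
    unfolding inner_vec_def transpose_def using sum.swap by simp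
  then show ?thesis by (simp add: norm_eq_sqrt_inner)
qed

lemma linear_transpose: "linear (transpose :: real^'c^'r \<Rightarrow> _)"
  by (rule linearI) (simp_all add: transpose_def vec_eq_iff)

lemma inner_transpose_mult:
  fixes M :: "real^'c^'r"
  shows "(transpose M *v u) \<bullet> v = u \<bullet> (M *v v)"
  using dot_lmul_matrix[of u M v] by (simp add: transpose_matrix_vector)

lemma inner_transpose_mult_right:
  fixes M :: "real^'c^'r"
  shows "v \<bullet> (transpose M *v u) = (M *v v) \<bullet> u"
  using inner_transpose_mult[of M u v] by (simp add: inner_commute)

definition outer_prod :: "real^'r \<Rightarrow> real^'c \<Rightarrow> real^'c^'r" where
  "outer_prod r c = (\<chi> i j. r $ i * c $ j)"

text \<open>The rank-one matrix represents the functional \<open>r \<bullet> (E *v c)\<close> of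
  \<open>E\<close> in the Frobenius inner product; the adjoint of the derivative is read off from
  this.\<close>

lemma inner_outer_prod: "E \<bullet> outer_prod r c = r \<bullet> (E *v c)"
  unfolding inner_vec_def matrix_vector_mult_def outer_prod_def
  by (simp add: sum_distrib_left mult_ac)

lemma outer_prod_mult: "outer_prod r c *v v = (c \<bullet> v) *\<^sub>R r"
  unfolding inner_vec_def matrix_vector_mult_def outer_prod_def vec_eq_iff
  by (simp add: sum_distrib_left mult_ac)

lemma norm_orthonormal_mult:
  fixes U :: "real^'c^'r"
  assumes "transpose U ** U = mat 1"
  shows "norm (U *v v) = norm v"
proof -
  have "(U *v v) \<bullet> (U *v v) = v \<bullet> v"
    using inner_transpose_mult[of U "U *v v" v] assms
    by (simp add: matrix_vector_mul_assoc)
  then show ?thesis by (simp add: norm_eq_sqrt_inner)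
qed

lemma diag_mat_mult: "(diag_mat d *v v) $ i = d i * v $ i"
proof -
  have "(\<Sum>j\<in>UNIV. (if i = j then d i else 0) * v $ j) = (\<Sum>j\<in>UNIV. if i = j then d i * v $ j else 0)"
    by (rule sum.cong) auto
  then show ?thesis by (simp add: diag_mat_def matrix_vector_mult_def)
qed

lemma transpose_diag_mat: "transpose (diag_mat d) = diag_mat d"
  by (auto simp: diag_mat_def transpose_def vec_eq_iff)

lemma norm_vec_sq: "(norm v)\<^sup>2 = (\<Sum>i\<in>UNIV. (v $ i)\<^sup>2)" for v :: "real^'c"
  unfolding power2_norm_eq_inner inner_vec_def by (simp add: power2_eq_square)

section \<open>Appending a column\<close>

definition vec_snoc :: "real^'n \<Rightarrow> real \<Rightarrow> real^('n option)" where
  "vec_snoc x t = (\<chi> j. case j of Some i \<Rightarrow> x $ i | None \<Rightarrow> t)"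

lemma sum_option: "(\<Sum>j\<in>UNIV. f j) = f None + (\<Sum>i\<in>UNIV. f (Some i))"
  for f :: "'n::finite option \<Rightarrow> 'a::comm_monoid_add"
  by (simp add: UNIV_option_conv sum.insert sum.reindex)

lemma vec_snoc_cases:
  obtains y t where "w = vec_snoc y t"
proof
  show "w = vec_snoc (\<chi> i. w $ Some i) (w $ None)"
    by (auto simp: vec_snoc_def vec_eq_iff split: option.split)
qed

lemma inner_vec_snoc: "vec_snoc x s \<bullet> vec_snoc y t = x \<bullet> y + s * t"
  by (simp add: inner_vec_def sum_option vec_snoc_def)

lemma norm_vec_snoc_sq: "(norm (vec_snoc x t))\<^sup>2 = (norm x)\<^sup>2 + t\<^sup>2"
  unfolding power2_norm_eq_inner inner_vec_snoc by (simp add: power2_eq_square)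

lemma append_col_mult: "append_col M v *v vec_snoc y t = M *v y + t *\<^sub>R v"
  by (simp add: vec_eq_iff matrix_vector_mult_def append_col_def vec_snoc_def sum_option)

lemma transpose_append_col_mult:
  "transpose (append_col M v) *v u = vec_snoc (transpose M *v u) (v \<bullet> u)"
  by (auto simp: vec_eq_iff matrix_vector_mult_def append_col_def vec_snoc_def transpose_def
      inner_vec_def split: option.split)

lemma matrix_mult_append_col: "B ** append_col M v = append_col (B ** M) (B *v v)"
  by (auto simp: vec_eq_iff matrix_vector_mult_def matrix_matrix_mult_def append_col_def
      split: option.split)

lemma linear_append_col: "linear (\<lambda>p. append_col (fst p) (snd p))"
  by (rule linearI) (auto simp: append_col_def vec_eq_iff split: option.split)

lemma norm_append_col: "norm (append_col M v) = norm (M, v)"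
proof -
  have "append_col M v \<bullet> append_col M v = M \<bullet> M + v \<bullet> v"
    unfolding inner_vec_def append_col_def by (simp add: sum_option sum.distrib)
  then show ?thesis by (simp add: norm_eq_sqrt_inner)
qed

section \<open>The smallest singular value\<close>

text \<open>The variational form of the smallest singular value makes sense for all nearby matrices
  without choosing decompositions; \<open>smin_thin_svd\<close> makes the link.\<close>

definition smin :: "real^'c^'r \<Rightarrow> real" where
  "smin M = (INF v\<in>sphere 0 1. norm (M *v v))"

lemma smin_attained:
  obtains v where "norm v = 1" "norm (M *v v) = smin M" "\<And>w. norm w = 1 \<Longrightarrow> smin M \<le> norm (M *v w)"
proof -
  have "axis undefined 1 \<in> sphere (0::real^'a) 1" by (simp add: dist_norm)
  then have "sphere (0::real^'a) 1 \<noteq> {}" by blast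
  moreover have "continuous_on (sphere 0 1) (\<lambda>v. norm (M *v v))"
    by (intro continuous_intros linear_continuous_on matrix_vector_mul_bounded_linear)
  ultimately obtain v where v: "v \<in> sphere 0 1" "\<And>w. w \<in> sphere 0 1 \<Longrightarrow> norm (M *v v) \<le> norm (M *v w)"
    using continuous_attains_inf[OF compact_sphere] by metis
  have "smin M = norm (M *v v)"
    unfolding smin_def by (rule cInf_eq_minimum) (use v in auto)
  with v that show ?thesis by simp
qed

lemma smin_nonneg: "0 \<le> smin M"
  by (metis norm_ge_zero smin_attained)

lemma smin_le: "smin M * norm v \<le> norm (M *v v)"
proof (cases "v = 0")
  case False
  have "smin M \<le> norm (M *v (v /\<^sub>R norm v))"
    by (rule smin_attained[of M]) (use False in simp)
  with False show ?thesis
    by (simp add: matrix_vector_mult_scaleR field_simps)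
qed simp

lemma smin_sq_le: "(smin M)\<^sup>2 * (norm v)\<^sup>2 \<le> (norm (M *v v))\<^sup>2"
  using power_mono[OF smin_le, of M v 2] by (simp add: smin_nonneg power_mult_distrib)

lemma smin_geI:
  assumes "\<And>v. norm v = 1 \<Longrightarrow> c \<le> norm (M *v v)"
  shows "c \<le> smin M"
  by (metis assms smin_attained)

lemma smin_lipschitz: "\<bar>smin M - smin N\<bar> \<le> norm (M - N)"
proof -
  have *: "smin M - norm (M - N) \<le> smin N" for M N :: "real^'c^'r"
  proof (rule smin_geI)
    fix v :: "real^'c" assume v: "norm v = 1"
    have "smin M \<le> norm (M *v v)" using smin_le[of M v] v by simp
    also have "M *v v = N *v v + (M - N) *v v" by (simp add: algebra_simps)
    also have "norm \<dots> \<le> norm (N *v v) + norm (M - N)"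
      using norm_matrix_vector_mult_le[of "M - N" v] v by (intro norm_triangle_mono) auto
    finally show "smin M - norm (M - N) \<le> norm (N *v v)" by simp
  qed
  show ?thesis using *[of M N] *[of N M] by (simp add: norm_minus_commute abs_le_iff)
qed

lemma continuous_on_smin: "continuous_on UNIV smin"
  by (rule lipschitz_on_continuous_on[of 1], rule lipschitz_onI)
    (auto simp: dist_norm dist_real_def smin_lipschitz)

lemmas tendsto_smin = continuous_on_tendsto_compose[OF continuous_on_smin, simplified]

text \<open>The quadratic form \<open>\<parallel>M w\<parallel>\<^sup>2 - smin\<^sup>2 \<parallel>w\<parallel>\<^sup>2\<close> is nonnegative, hence stationary at its zeros.\<close>

lemma smin_vector_eigen:
  assumes "(norm (M *v w))\<^sup>2 = (smin M)\<^sup>2 * (norm w)\<^sup>2"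
  shows "(M *v w) \<bullet> (M *v h) = (smin M)\<^sup>2 * (w \<bullet> h)"
proof -
  define B where "B = (M *v w) \<bullet> (M *v h) - (smin M)\<^sup>2 * (w \<bullet> h)"
  define q where "q = (norm (M *v h))\<^sup>2 - (smin M)\<^sup>2 * (norm h)\<^sup>2"
  \<comment> \<open>The right side is the form at \<open>w + t *\<^sub>R h\<close>, whose constant
    term vanishes by assumption.\<close>
  have pos: "0 \<le> 2 * t * B + t\<^sup>2 * q" for t
  proof -
    have "(smin M)\<^sup>2 * (norm (w + t *\<^sub>R h))\<^sup>2 \<le> (norm (M *v (w + t *\<^sub>R h)))\<^sup>2"
      by (rule smin_sq_le)
    then show ?thesis using assms unfolding B_def q_def power2_norm_eq_inner
      by (simp add: matrix_vector_right_distrib matrix_vector_mult_scaleR inner_add_left inner_add_right inner_commute algebra_simps power2_eq_square)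
  qed
  have q0: "0 \<le> q" unfolding q_def using smin_sq_le[of M h] by simp
  have "B = 0"
  proof (rule ccontr)
    assume B: "B \<noteq> 0"
    \<comment> \<open>The parabola has its minimum at \<open>- B / q\<close>; using
      \<open>q + 1\<close> instead also covers \<open>q = 0\<close> and still gives a negative
      value.\<close>
    have "2 * (- B / (q + 1)) * B + (- B / (q + 1))\<^sup>2 * q = - (B\<^sup>2 * (q + 2) / (q + 1)\<^sup>2)"
      using q0 by (simp add: divide_simps power2_eq_square) (simp add: algebra_simps)
    moreover have "B\<^sup>2 * (q + 2) / (q + 1)\<^sup>2 > 0" using B q0 by (intro divide_pos_pos mult_pos_pos) auto
    ultimately show False using pos[of "- B / (q + 1)"] by linarith
  qed
  then show ?thesis by (simp add: B_def)
qed

section \<open>The total least squares solution\<close>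

definition tls_generic :: "real^'n^'m \<Rightarrow> real^'m \<Rightarrow> bool" where
  "tls_generic A b \<longleftrightarrow> smin (append_col A b) < smin A"

definition tls_value :: "real^'n^'m \<Rightarrow> real^'m \<Rightarrow> real" where
  "tls_value A b = (smin (append_col A b))\<^sup>2"

lemma tls_value_less: "tls_generic A b \<Longrightarrow> tls_value A b < (smin A)\<^sup>2"
  unfolding tls_generic_def tls_value_def by (intro power_strict_mono smin_nonneg) auto

lemma tls_value_le: "tls_value A b * (1 + (norm y)\<^sup>2) \<le> (norm (A *v y - b))\<^sup>2"
  using smin_sq_le[of "append_col A b" "vec_snoc y (-1)"]
  by (simp add: append_col_mult norm_vec_snoc_sq tls_value_def add.commute)

text \<open>Under genericity the constant on the left is positive, so
  \<open>A\<^sup>T A - \<lambda> I\<close> is positive definite. Uniqueness, boundedness and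
  continuity of the solution all rest on this.\<close>

lemma tls_coercive:
  "((smin A)\<^sup>2 - tls_value A b) * (norm y)\<^sup>2 \<le> y \<bullet> (transpose A *v (A *v y) - tls_value A b *\<^sub>R y)"
  using smin_sq_le[of A y]
  by (simp add: inner_diff_right inner_transpose_mult_right power2_norm_eq_inner left_diff_distrib)

text \<open>Equality in \<open>tls_value_le\<close>: the vector \<open>(x, -1)\<close> is a right
  singular vector of \<open>[A, b]\<close> for its smallest singular value.\<close>

definition tls_point :: "real^'n^'m \<Rightarrow> real^'m \<Rightarrow> real^'n \<Rightarrow> bool" where
  "tls_point A b x \<longleftrightarrow> (norm (A *v x - b))\<^sup>2 = tls_value A b * (1 + (norm x)\<^sup>2)"

text \<open>The test vector \<open>(y, t)\<close> is kept general: \<open>t = 0\<close> yields the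
  normal equation, \<open>t = -1\<close> the perturbation identity for the minimal value.\<close>

lemma tls_point_stationary:
  assumes "tls_point A b x"
  shows "(A *v x - b) \<bullet> (A *v y + t *\<^sub>R b) = tls_value A b * (x \<bullet> y - t)"
  using smin_vector_eigen[of "append_col A b" "vec_snoc x (-1)" "vec_snoc y t"] assms
  by (simp add: append_col_mult norm_vec_snoc_sq tls_value_def inner_vec_snoc tls_point_def add.commute)

lemma tls_point_normal_equation:
  assumes "tls_point A b x"
  shows "transpose A *v (A *v x - b) = tls_value A b *\<^sub>R x"
proof (rule vector_eq_ldot[THEN iffD1], rule)
  fix y
  show "y \<bullet> (transpose A *v (A *v x - b)) = y \<bullet> (tls_value A b *\<^sub>R x)"
    using tls_point_stationary[OF assms, of y 0]
    by (simp add: inner_transpose_mult_right inner_commute)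
qed

text \<open>If the last entry of \<open>w\<close> were 0, the rest of \<open>w\<close> would be
  stretched by \<open>A\<close> by only \<open>smin (append_col A b)\<close>, against genericity.
  Hence \<open>w\<close> can be rescaled to end in -1.\<close>

lemma smin_vector_snoc:
  assumes "tls_generic A b" "norm (append_col A b *v w) = smin (append_col A b) * norm w" "w \<noteq> 0"
  obtains y t where "w = t *\<^sub>R vec_snoc y (-1)" "t \<noteq> 0" "tls_point A b y"
proof -
  obtain z s where w: "w = vec_snoc z s" by (rule vec_snoc_cases)
  have s: "s \<noteq> 0"
  proof
    assume s: "s = 0"
    have "norm w = norm z"
      using norm_vec_snoc_sq[of z s] w s by (simp add: power2_eq_iff_nonneg)
    moreover from this assms(3) have "norm z > 0" by auto
    moreover have "smin A * norm z \<le> smin (append_col A b) * norm w"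
      using smin_le[of A z] assms(2) by (simp add: w s append_col_mult)
    ultimately show False using assms(1) by (simp add: tls_generic_def)
  qed
  define t where "t = - s"
  define y where "y = (1 / t) *\<^sub>R z"
  have t: "t \<noteq> 0" using s by (simp add: t_def)
  have wy: "w = t *\<^sub>R vec_snoc y (-1)"
    unfolding w y_def using t by (auto simp: vec_snoc_def t_def vec_eq_iff split: option.split)
  have "norm (append_col A b *v vec_snoc y (-1)) = smin (append_col A b) * norm (vec_snoc y (-1))"
    using assms(2) t unfolding wy by (simp add: matrix_vector_mult_scaleR)
  then have "(norm (append_col A b *v vec_snoc y (-1)))\<^sup>2
      = (smin (append_col A b))\<^sup>2 * (norm (vec_snoc y (-1)))\<^sup>2"
    by (simp add: power_mult_distrib)
  then have "tls_point A b y"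
    by (simp add: tls_point_def tls_value_def append_col_mult norm_vec_snoc_sq add.commute)
  with wy t show ?thesis by (rule that)
qed

lemma tls_point_exists:
  assumes "tls_generic A b"
  obtains x where "tls_point A b x"
proof -
  obtain v where "norm v = 1" "norm (append_col A b *v v) = smin (append_col A b)"
    using smin_attained by metis
  then show ?thesis
    using smin_vector_snoc[OF assms, of v] that by fastforce
qed

text \<open>Both normal equations have the same \<open>tls_value A b\<close>, so
  \<open>A\<^sup>T b\<close> cancels in their difference and coercivity applies.\<close>

lemma tls_point_unique:
  assumes "tls_generic A b" "tls_point A b x" "tls_point A b y"
  shows "x = y"
proof -
  have "transpose A *v (A *v (x - y)) - tls_value A b *\<^sub>R (x - y) = 0"
    using tls_point_normal_equation[OF assms(2)] tls_point_normal_equation[OF assms(3)]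
    by (simp add: matrix_vector_mult_diff_distrib algebra_simps)
  then have "((smin A)\<^sup>2 - tls_value A b) * (norm (x - y))\<^sup>2 \<le> 0"
    using tls_coercive[of A b "x - y"] by simp
  with tls_value_less[OF assms(1)] show ?thesis
    by (simp add: mult_le_0_iff)
qed

text \<open>A correction making \<open>x\<close> feasible maps \<open>(x, -1)\<close> to the negative residual, so it has norm at least
  \<open>\<parallel>A x - b\<parallel> / sqrt (1 + \<parallel>x\<parallel>\<^sup>2)\<close>, and a rank-one correction attains this.\<close>

lemma tls_correction_ge:
  fixes A E :: "real^'n^'m"
  assumes "(A + E) *v x = b + e"
  shows "(norm (A *v x - b))\<^sup>2 \<le> (norm (E, e))\<^sup>2 * (1 + (norm x)\<^sup>2)"
proof -
  have "A *v x - b = - (append_col E e *v vec_snoc x (-1))"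
    using assms by (simp add: append_col_mult algebra_simps)
  then have "norm (A *v x - b) \<le> norm (E, e) * norm (vec_snoc x (-1))"
    using norm_matrix_vector_mult_le[of "append_col E e" "vec_snoc x (-1)"]
    by (simp add: norm_append_col)
  from power_mono[OF this norm_ge_zero, of 2] show ?thesis
    by (simp add: power_mult_distrib norm_vec_snoc_sq add.commute)
qed

lemma tls_correction_exists:
  fixes A :: "real^'n^'m"
  obtains E e where "(A + E) *v x = b + e"
    "(norm (E, e))\<^sup>2 * (1 + (norm x)\<^sup>2) = (norm (A *v x - b))\<^sup>2"
proof -
  define \<beta> where "\<beta> = 1 + (norm x)\<^sup>2"
  define r where "r = A *v x - b"
  have \<beta>: "\<beta> > 0" unfolding \<beta>_def by (simp add: add_pos_nonneg)
  \<comment> \<open>Together \<open>[E, e]\<close> is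
    \<open>- (r / \<beta>) (x, -1)\<^sup>T\<close>, the rank-one matrix that sends
    \<open>(x, -1)\<close> to \<open>- r\<close>, since \<open>\<beta>\<close> is the squared norm
    of \<open>(x, -1)\<close>.\<close>
  define E where "E = outer_prod ((- 1 / \<beta>) *\<^sub>R r) x"
  define e where "e = (1 / \<beta>) *\<^sub>R r"
  have xx: "x \<bullet> x = \<beta> - 1" by (simp add: \<beta>_def power2_norm_eq_inner)
  have "E *v x - e = - (1 / \<beta> * (\<beta> - 1) + 1 / \<beta>) *\<^sub>R r"
    by (simp add: E_def e_def outer_prod_mult xx algebra_simps)
  also have "1 / \<beta> * (\<beta> - 1) + 1 / \<beta> = 1" using \<beta> by (simp add: field_simps)
  finally have "(A + E) *v x = b + e" by (simp add: r_def algebra_simps)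
  moreover have "(norm (E, e))\<^sup>2 * \<beta> = (norm r)\<^sup>2"
  proof -
    have "(norm (E, e))\<^sup>2 = E \<bullet> E + e \<bullet> e" by (simp add: power2_norm_eq_inner)
    also have "\<dots> = (r \<bullet> r) / \<beta>" using \<beta>
      by (simp add: E_def e_def inner_outer_prod outer_prod_mult xx divide_simps)
        (simp add: algebra_simps)
    finally show ?thesis using \<beta> by (simp add: power2_norm_eq_inner)
  qed
  ultimately show ?thesis using that[of E e] by (simp add: r_def \<beta>_def)
qed

text \<open>For fixed \<open>x\<close> the least squared correction is the Rayleigh quotient of
  \<open>[A, b]\<^sup>T[A, b]\<close> at \<open>(x, -1)\<close>. Genericity ensures that its lower
  bound \<open>tls_value A b\<close> is attained by some such vector.\<close>

lemma is_tls_solution_iff: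
  fixes A :: "real^'n^'m"
  assumes "tls_generic A b"
  shows "is_tls_solution A b x \<longleftrightarrow> tls_point A b x"
proof
  have pos: "1 + (norm y)\<^sup>2 > 0" for y :: "real^'n" by (simp add: add_pos_nonneg)
  have lower: "tls_value A b \<le> (norm (E, e))\<^sup>2" if "(A + E) *v y = b + e" for E e y
  proof -
    have "tls_value A b * (1 + (norm y)\<^sup>2) \<le> (norm (E, e))\<^sup>2 * (1 + (norm y)\<^sup>2)"
      using tls_value_le tls_correction_ge[OF that] by (rule order_trans)
    then show ?thesis using pos[of y] by simp
  qed
  have attained: "\<exists>E e. (A + E) *v y = b + e \<and> (norm (E, e))\<^sup>2 = tls_value A b"
    if "tls_point A b y" for y
  proof -
    obtain E e where "(A + E) *v y = b + e" "(norm (E, e))\<^sup>2 * (1 + (norm y)\<^sup>2) = (norm (A *v y - b))\<^sup>2"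
      by (rule tls_correction_exists)
    moreover from this that have "(norm (E, e))\<^sup>2 = tls_value A b"
      using pos[of y] unfolding tls_point_def by simp
    ultimately show ?thesis by blast
  qed
  show "is_tls_solution A b x" if pt: "tls_point A b x"
  proof -
    obtain E e where E: "(A + E) *v x = b + e" "(norm (E, e))\<^sup>2 = tls_value A b"
      using attained[OF pt] by blast
    have "norm (E, e) \<le> norm (E', e')" if "(A + E') *v y = b + e'" for E' e' y
      using lower[OF that] E(2) by (metis norm_ge_zero power2_le_imp_le)
    with E show ?thesis unfolding is_tls_solution_def by blast
  qed
  show "tls_point A b x" if sol: "is_tls_solution A b x"
  proof -
    \<comment> \<open>Comparison with a point attaining the lower bound forces the optimal
      correction for \<open>x\<close> down to that bound.\<close>
    obtain z where z: "tls_point A b z" using tls_point_exists[OF assms] .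
    obtain E0 e0 where E0: "(A + E0) *v z = b + e0" "(norm (E0, e0))\<^sup>2 = tls_value A b"
      using attained[OF z] by blast
    obtain E e where E: "(A + E) *v x = b + e" "norm (E, e) \<le> norm (E0, e0)"
      using sol E0(1) unfolding is_tls_solution_def by blast
    have "(norm (E, e))\<^sup>2 \<le> tls_value A b"
      using power_mono[OF E(2), of 2] E0(2) by simp
    then have "(norm (E, e))\<^sup>2 * (1 + (norm x)\<^sup>2) \<le> tls_value A b * (1 + (norm x)\<^sup>2)"
      using pos[of x] by simp
    with tls_correction_ge[OF E(1)] tls_value_le[of A b x] show ?thesis
      unfolding tls_point_def by linarith
  qed
qed

lemma tls_point_tls_solution:
  assumes "tls_generic A b"
  shows "tls_point A b (tls_solution A b)"
proof -
  have "\<exists>!x. is_tls_solution A b x"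
    unfolding is_tls_solution_iff[OF assms]
    using tls_point_exists[OF assms] tls_point_unique[OF assms] by metis
  from theI'[OF this] show ?thesis
    unfolding tls_solution_def is_tls_solution_iff[OF assms] .
qed

section \<open>Perturbation and differentiability\<close>

text \<open>Every term on the right of the value identity, and every term of the point identity
  apart from the multiple of \<open>x'\<close>, contains a factor linear in the data increment. The
  coefficient of \<open>x'\<close> is the increment governed by the value identity.\<close>

lemma tls_perturbation:
  assumes "tls_point A b x" "tls_point A' b' x'"
  shows tls_value_perturbation:
    "(tls_value A' b' - tls_value A b) * (1 + x \<bullet> x') =
       (A' *v x' - b') \<bullet> ((A' - A) *v x - (b' - b)) + (A *v x - b) \<bullet> ((A' - A) *v x' - (b' - b))"
      (is "?value")
    and tls_point_perturbation:
    "transpose A *v (A *v (x' - x)) - tls_value A b *\<^sub>R (x' - x) =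
       (tls_value A' b' - tls_value A b) *\<^sub>R x' -
       (transpose (A' - A) *v (A' *v x' - b') + transpose A *v ((A' - A) *v x' - (b' - b)))"
      (is "?point")
proof -
  \<comment> \<open>Each stationarity equation is tested with the solution of the other problem, so
    both produce the factor \<open>1 + x \<bullet> x'\<close>; the product of the two residuals
    cancels on subtraction.\<close>
  have "(A' *v x' - b') \<bullet> (A' *v x - b') = tls_value A' b' * (1 + x \<bullet> x')"
    using tls_point_stationary[OF assms(2), of x "-1"] by (simp add: inner_commute)
  moreover have "(A *v x - b) \<bullet> (A *v x' - b) = tls_value A b * (1 + x \<bullet> x')"
    using tls_point_stationary[OF assms(1), of x' "-1"] by simp
  ultimately show ?value
    by (simp add: left_diff_distrib algebra_simps inner_diff_left inner_diff_right inner_commute)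
  show ?point
    using tls_point_normal_equation[OF assms(1)] tls_point_normal_equation[OF assms(2)]
    by (simp add: linear_diff[OF linear_transpose] algebra_simps)
qed

lemma tls_point_norm_bound:
  assumes "tls_generic A b" "tls_point A b x"
  shows "norm x \<le> norm A * norm b / ((smin A)\<^sup>2 - tls_value A b)"
proof -
  have "((smin A)\<^sup>2 - tls_value A b) * (norm x)\<^sup>2 \<le> x \<bullet> (transpose A *v b)"
    using tls_coercive[of A b x] tls_point_normal_equation[OF assms(2)]
    by (simp add: matrix_vector_mult_diff_distrib inner_diff_right algebra_simps)
  also have "\<dots> \<le> norm x * (norm A * norm b)"
    using norm_matrix_vector_mult_le[of "transpose A" b] norm_cauchy_schwarz[of x]
    by (smt (verit) norm_transpose mult_left_mono norm_ge_zero)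
  finally have "((smin A)\<^sup>2 - tls_value A b) * norm x \<le> norm A * norm b"
    by (cases "x = 0") (auto simp: power2_eq_square)
  with tls_value_less[OF assms(1)] show ?thesis by (simp add: field_simps)
qed

text \<open>Coercivity is applied at the base data only, so the denominator stays fixed while the
  numerator tends to 0 with the increment as long as \<open>k\<close> stays bounded.\<close>

lemma tls_point_dist_bound:
  fixes A A' :: "real^'n^'m"
  assumes "tls_generic A b" "tls_point A b x" "tls_point A' b' x'" "norm x' \<le> k"
  shows "norm (x' - x) \<le> (\<bar>tls_value A' b' - tls_value A b\<bar> * k + norm (A' - A) * (norm A' * k + norm b')
    + norm A * (norm (A' - A) * k + norm (b' - b))) / ((smin A)\<^sup>2 - tls_value A b)"
proof -
  let ?S = "transpose A *v (A *v (x' - x)) - tls_value A b *\<^sub>R (x' - x)"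
  have res: "norm (M *v x' - v) \<le> norm M * k + norm v" for M :: "real^'n^'m" and v
    using norm_matrix_vector_mult_le[of M x'] norm_triangle_ineq4[of "M *v x'" v]
      mult_left_mono[OF assms(4) norm_ge_zero[of M]] by linarith
  have tr: "norm (transpose M *v v) \<le> norm M * d" if "norm v \<le> d" for M :: "real^'n^'m" and v d
    using norm_matrix_vector_mult_le[of "transpose M" v] mult_left_mono[OF that norm_ge_zero[of M]]
    by (simp add: norm_transpose)
  have "((smin A)\<^sup>2 - tls_value A b) * (norm (x' - x))\<^sup>2 \<le> norm (x' - x) * norm ?S"
    using tls_coercive[of A b "x' - x"] norm_cauchy_schwarz[of "x' - x" ?S] by linarith
  then have "((smin A)\<^sup>2 - tls_value A b) * norm (x' - x) \<le> norm ?S"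
    by (cases "x' = x") (auto simp: power2_eq_square)
  also have "\<dots> \<le> \<bar>tls_value A' b' - tls_value A b\<bar> * k + (norm (A' - A) * (norm A' * k + norm b')
    + norm A * (norm (A' - A) * k + norm (b' - b)))"
    unfolding tls_point_perturbation[OF assms(2,3)]
    by (intro order_trans[OF norm_triangle_ineq4] order_trans[OF norm_triangle_ineq] add_mono tr res)
      (auto intro: mult_left_mono assms(4))
  finally show ?thesis
    using tls_value_less[OF assms(1)] by (simp add: field_simps)
qed

section \<open>Openness of genericity and continuity of the solution\<close>

lemma tendsto_append_col:
  assumes "(f \<longlongrightarrow> A) F" "(g \<longlongrightarrow> b) F"
  shows "((\<lambda>p. append_col (f p) (g p)) \<longlongrightarrow> append_col A b) F"
  using bounded_linear.tendsto[OF linear_append_col[THEN linear_conv_bounded_linear[THEN iffD1]] tendsto_Pair[OF assms]]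
  by simp

lemma eventually_tls_generic:
  assumes "tls_generic A b"
  shows "\<forall>\<^sub>F p in at (A, b). tls_generic (fst p) (snd p)"
proof -
  have "((\<lambda>p. smin (append_col (fst p) (snd p)) - smin (fst p)) \<longlongrightarrow> smin (append_col A b) - smin A) (at (A, b))"
    by (auto intro!: tendsto_eq_intros tendsto_smin tendsto_append_col)
  moreover have "smin (append_col A b) - smin A < 0" using assms by (simp add: tls_generic_def)
  ultimately have "\<forall>\<^sub>F p in at (A, b). smin (append_col (fst p) (snd p)) - smin (fst p) < 0"
    by (rule order_tendstoD)
  then show ?thesis by eventually_elim (simp add: tls_generic_def)
qed

lemma tendsto_tls_value:
  "((\<lambda>p. tls_value (fst p) (snd p)) \<longlongrightarrow> tls_value A b) (at (A, b))"
  unfolding tls_value_def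
  by (auto intro!: tendsto_eq_intros tendsto_smin tendsto_append_col)

lemma tendsto_tls_solution:
  assumes "tls_generic A b"
  shows "((\<lambda>p. tls_solution (fst p) (snd p)) \<longlongrightarrow> tls_solution A b) (at (A, b))"
proof -
  \<comment> \<open>The a priori bound of \<open>tls_point_norm_bound\<close> at the perturbed data;
    it converges because the spectral gap at \<open>(A, b)\<close> is positive.\<close>
  define k where "k p = norm (fst p) * norm (snd p) / ((smin (fst p))\<^sup>2 - tls_value (fst p) (snd p))"
    for p :: "(real^'a^'b) \<times> (real^'b)"
  define H where "H p = (\<bar>tls_value (fst p) (snd p) - tls_value A b\<bar> * k p
      + norm (fst p - A) * (norm (fst p) * k p + norm (snd p))
      + norm A * (norm (fst p - A) * k p + norm (snd p - b))) / ((smin A)\<^sup>2 - tls_value A b)" for p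
  have pos: "(smin A)\<^sup>2 - tls_value A b > 0" using tls_value_less[OF assms] by simp
  have "\<forall>\<^sub>F p in at (A, b). norm (tls_solution (fst p) (snd p) - tls_solution A b) \<le> H p"
    using eventually_tls_generic[OF assms]
  proof eventually_elim
    case (elim p)
    show ?case unfolding H_def k_def
      by (intro tls_point_dist_bound tls_point_norm_bound tls_point_tls_solution assms elim)
  qed
  moreover have k: "(k \<longlongrightarrow> k (A, b)) (at (A, b))"
    unfolding k_def using pos
    by (auto intro!: tendsto_eq_intros tendsto_smin tendsto_tls_value)
  have "(H \<longlongrightarrow> 0) (at (A, b))"
    unfolding H_def using pos
    by (auto intro!: tendsto_eq_intros tendsto_tls_value k)
  ultimately have "((\<lambda>p. tls_solution (fst p) (snd p) - tls_solution A b) \<longlongrightarrow> 0) (at (A, b))"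
    by (rule Lim_null_comparison)
  then show ?thesis by (simp add: LIM_zero_iff)
qed

text \<open>If one factor vanishes at the point, continuity of the other suffices for differentiability
  of the product.\<close>

lemma has_derivative_bilinear_zero:
  assumes "bounded_bilinear B" "(f has_derivative F) (at a)" "f a = 0" "(h \<longlongrightarrow> h a) (at a)"
  shows "((\<lambda>x. B (f x) (h x)) has_derivative (\<lambda>d. B (F d) (h a))) (at a)"
proof -
  interpret bounded_bilinear B by fact
  have F: "bounded_linear F" using assms(2) by (rule has_derivative_bounded_linear)
  have lim: "((\<lambda>y. (f y - f a - F (y - a)) /\<^sub>R norm (y - a)) \<longlongrightarrow> 0) (at a)"
    using assms(2) by (simp add: has_derivative_at_within)
  obtain K where K: "\<And>d. norm (F d) \<le> norm d * K" "K > 0"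
    using bounded_linear.pos_bounded[OF F] by blast
  have bnd: "norm (F (y - a) /\<^sub>R norm (y - a)) \<le> K" for y
    using K(1)[of "y - a"] K(2) by (cases "y = a") (auto simp: field_simps)
  have "((\<lambda>y. h y - h a) \<longlongrightarrow> 0) (at a)" using assms(4) by (simp add: LIM_zero_iff)
  \<comment> \<open>The remainder of the product splits in two: a bounded quotient of
    \<open>F\<close> paired with an increment of \<open>h\<close> tending to 0, and the remainder
    quotient of \<open>f\<close> paired with the convergent \<open>h\<close>.\<close>
  then have "((\<lambda>y. B (F (y - a) /\<^sub>R norm (y - a)) (h y - h a)) \<longlongrightarrow> 0) (at a)"
    unfolding tendsto_Zfun_iff diff_0_right
    by (rule Bfun_prod_Zfun[rotated]) (rule BfunI, rule always_eventually, use bnd in blast)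
  moreover have "((\<lambda>y. B ((f y - f a - F (y - a)) /\<^sub>R norm (y - a)) (h y)) \<longlongrightarrow> B 0 (h a)) (at a)"
    by (intro tendsto lim assms(4))
  ultimately have "((\<lambda>y. B ((f y - f a - F (y - a)) /\<^sub>R norm (y - a)) (h y)
      + B (F (y - a) /\<^sub>R norm (y - a)) (h y - h a)) \<longlongrightarrow> 0 + 0) (at a)"
    by (intro tendsto_add) (auto simp: zero_left)
  moreover have "B ((f y - f a - F (y - a)) /\<^sub>R norm (y - a)) (h y)
      + B (F (y - a) /\<^sub>R norm (y - a)) (h y - h a)
      = (B (f y) (h y) - B (f a) (h a) - B (F (y - a)) (h a)) /\<^sub>R norm (y - a)" for y
    by (simp add: assms(3) zero_left scaleR_left scaleR_right diff_left diff_right algebra_simps)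
  ultimately show ?thesis
    unfolding has_derivative_at_within
    using bounded_linear_compose[OF bounded_linear_left F] by simp
qed

text \<open>Applying \<open>R\<close> to the point identity solves it for the increment of the
  solution. The resulting formula holds near \<open>(A, b)\<close>, and its nonconstant terms are
  differentiated by the product rule with a vanishing factor or by linearity.\<close>

lemma has_derivative_tls_solution:
  fixes A :: "real^'n^'m"
  assumes gen: "tls_generic A b" and x: "x = tls_solution A b"
    and R: "\<And>y. R *v (transpose A *v (A *v y) - tls_value A b *\<^sub>R y) = y"
  shows "((\<lambda>p. tls_solution (fst p) (snd p)) has_derivative
    (\<lambda>d. R *v ((2 * ((A *v x - b) \<bullet> (fst d *v x - snd d)) / (1 + x \<bullet> x)) *\<^sub>R x
       - (transpose (fst d) *v (A *v x - b) + transpose A *v (fst d *v x - snd d))))) (at (A, b))"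
proof -
  define X where "X p = tls_solution (fst p) (snd p)" for p :: "(real^'n^'m) \<times> (real^'m)"
  define r where "r = A *v x - b"
  have X0: "X (A, b) = x" by (simp add: X_def x)
  have X: "(X \<longlongrightarrow> x) (at (A, b))"
    unfolding X_def x by (rule tendsto_tls_solution[OF gen])
  have res: "((\<lambda>p. fst p *v X p - snd p) \<longlongrightarrow> r) (at (A, b))"
    unfolding r_def
    by (auto intro!: tendsto_eq_intros X bounded_bilinear.tendsto[OF bounded_bilinear_matrix_vector_mult])
  have mat_vec: "((\<lambda>p. (fst p - A) *v X p) has_derivative (\<lambda>d. fst d *v x)) (at (A, b))"
  proof -
    have "((\<lambda>p. fst p - A) has_derivative fst) (at (A, b))"
      by (auto intro!: derivative_eq_intros)
    from has_derivative_bilinear_zero[OF bounded_bilinear_matrix_vector_mult this, of X] X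
    show ?thesis by (simp add: X0)
  qed
  have snd_diff: "((\<lambda>p. snd p - b) has_derivative snd) (at (A, b))"
    by (auto intro!: derivative_eq_intros)
  have trans: "((\<lambda>p. transpose (fst p - A) *v (fst p *v X p - snd p)) has_derivative
      (\<lambda>d. transpose (fst d) *v r)) (at (A, b))"
  proof -
    have "((\<lambda>p. transpose (fst p - A)) has_derivative (\<lambda>d. transpose (fst d))) (at (A, b))"
      by (rule bounded_linear.has_derivative[OF linear_transpose[THEN linear_conv_bounded_linear[THEN iffD1]]])
        (auto intro!: derivative_eq_intros)
    from has_derivative_bilinear_zero[OF bounded_bilinear_matrix_vector_mult this, of "\<lambda>p. fst p *v X p - snd p"]
    show ?thesis using res by (simp add: X0 r_def transpose_def zero_vec_def[symmetric])
  qed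
  have ne: "1 + x \<bullet> x \<noteq> 0" by (smt (verit) inner_ge_zero)
  \<comment> \<open>This factor may vanish for distant data, but its limit is positive, so division
    by it is legitimate near \<open>(A, b)\<close>.\<close>
  have den: "((\<lambda>p. 1 + x \<bullet> X p) \<longlongrightarrow> 1 + x \<bullet> x) (at (A, b))"
    by (intro tendsto_intros X)
  have val_deriv: "((\<lambda>p. tls_value (fst p) (snd p) - tls_value A b) has_derivative
      (\<lambda>d. 2 * (r \<bullet> (fst d *v x - snd d)) / (1 + x \<bullet> x))) (at (A, b))"
  proof -
    \<comment> \<open>The numerator in the value identity. Its two summands have the same
      derivative, which is the origin of the factor 2.\<close>
    define N where "N p = (fst p *v X p - snd p) \<bullet> ((fst p - A) *v x - (snd p - b))
        + r \<bullet> ((fst p - A) *v X p - (snd p - b))" for p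
    have "((\<lambda>p. (fst p - A) *v x - (snd p - b)) has_derivative (\<lambda>d. fst d *v x - snd d)) (at (A, b))"
      by (auto intro!: derivative_eq_intros bounded_linear.has_derivative[OF
            bounded_bilinear.bounded_linear_left[OF bounded_bilinear_matrix_vector_mult]])
    from has_derivative_bilinear_zero[OF bounded_bilinear_inner this, of "\<lambda>p. fst p *v X p - snd p"]
    have "((\<lambda>p. (fst p *v X p - snd p) \<bullet> ((fst p - A) *v x - (snd p - b))) has_derivative
        (\<lambda>d. r \<bullet> (fst d *v x - snd d))) (at (A, b))"
      using res by (simp add: X0 r_def inner_commute)
    moreover have "((\<lambda>p. r \<bullet> ((fst p - A) *v X p - (snd p - b))) has_derivative
        (\<lambda>d. r \<bullet> (fst d *v x - snd d))) (at (A, b))"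
      by (intro has_derivative_inner_right has_derivative_diff mat_vec snd_diff)
    ultimately have "(N has_derivative (\<lambda>d. 2 * (r \<bullet> (fst d *v x - snd d)))) (at (A, b))"
      unfolding N_def by (auto dest: has_derivative_add)
    moreover have "N (A, b) = 0" by (simp add: N_def)
    moreover have "((\<lambda>p. inverse (1 + x \<bullet> X p)) \<longlongrightarrow> inverse (1 + x \<bullet> X (A, b))) (at (A, b))"
      using tendsto_inverse[OF den ne] by (simp add: X0)
    ultimately have "((\<lambda>p. N p * inverse (1 + x \<bullet> X p)) has_derivative
        (\<lambda>d. 2 * (r \<bullet> (fst d *v x - snd d)) * inverse (1 + x \<bullet> X (A, b)))) (at (A, b))"
      by (rule has_derivative_bilinear_zero[OF bounded_bilinear_mult])
    then have "((\<lambda>p. N p * inverse (1 + x \<bullet> X p)) has_derivative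
        (\<lambda>d. 2 * (r \<bullet> (fst d *v x - snd d)) / (1 + x \<bullet> x))) (at (A, b))"
      by (simp add: X0 divide_inverse)
    moreover have "\<forall>\<^sub>F p in at (A, b). N p * inverse (1 + x \<bullet> X p) = tls_value (fst p) (snd p) - tls_value A b"
      using eventually_tls_generic[OF gen] tendsto_imp_eventually_ne[OF den ne]
    proof eventually_elim
      case (elim p)
      have "(tls_value (fst p) (snd p) - tls_value A b) * (1 + x \<bullet> X p) = N p"
        unfolding N_def r_def X_def x
        by (intro tls_value_perturbation tls_point_tls_solution gen elim)
      with elim(2) show ?case by (simp add: field_simps)
    qed
    ultimately show ?thesis
      by (rule has_derivative_transform_eventually) (simp_all add: N_def)
  qed
  have scaled: "((\<lambda>p. (tls_value (fst p) (snd p) - tls_value A b) *\<^sub>R X p) has_derivative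
      (\<lambda>d. (2 * (r \<bullet> (fst d *v x - snd d)) / (1 + x \<bullet> x)) *\<^sub>R x)) (at (A, b))"
    using has_derivative_bilinear_zero[OF bounded_bilinear_scaleR val_deriv, of X] X by (simp add: X0)
  have "((\<lambda>p. x + R *v ((tls_value (fst p) (snd p) - tls_value A b) *\<^sub>R X p
       - (transpose (fst p - A) *v (fst p *v X p - snd p)
          + transpose A *v ((fst p - A) *v X p - (snd p - b))))) has_derivative
    (\<lambda>d. 0 + R *v ((2 * (r \<bullet> (fst d *v x - snd d)) / (1 + x \<bullet> x)) *\<^sub>R x
       - (transpose (fst d) *v r + transpose A *v (fst d *v x - snd d))))) (at (A, b))"
    by (intro has_derivative_add has_derivative_diff has_derivative_const scaled trans mat_vec snd_diff
        bounded_linear.has_derivative[OF matrix_vector_mul_bounded_linear])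
  moreover have "\<forall>\<^sub>F p in at (A, b). x + R *v ((tls_value (fst p) (snd p) - tls_value A b) *\<^sub>R X p
       - (transpose (fst p - A) *v (fst p *v X p - snd p)
          + transpose A *v ((fst p - A) *v X p - (snd p - b)))) = X p"
    using eventually_tls_generic[OF gen]
  proof eventually_elim
    case (elim p)
    show ?case
      using tls_point_perturbation[OF tls_point_tls_solution[OF gen] tls_point_tls_solution[OF elim],
          folded x X_def] R[of "X p - x"] by simp
  qed
  ultimately have "(X has_derivative
    (\<lambda>d. 0 + R *v ((2 * (r \<bullet> (fst d *v x - snd d)) / (1 + x \<bullet> x)) *\<^sub>R x
       - (transpose (fst d) *v r + transpose A *v (fst d *v x - snd d))))) (at (A, b))"
    by (rule has_derivative_transform_eventually)
      (simp_all add: X0 linear_0[OF linear_transpose])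
  then show ?thesis by (simp add: X_def[abs_def] r_def)
qed

section \<open>The condition number as an operator norm\<close>

text \<open>Compactness of the unit sphere supplies the maximiser that \<open>GREATEST\<close> in
  \<open>tls_cond\<close> requires.\<close>

lemma onorm_attained:
  fixes f :: "'a::euclidean_space \<Rightarrow> 'b::real_normed_vector"
  assumes "bounded_linear f"
  obtains d where "d \<noteq> 0" "norm (f d) / norm d = onorm f"
proof -
  have lin: "linear f" using assms by (rule bounded_linear.linear)
  have "sphere (0::'a) 1 \<noteq> {}"
    using norm_some_Basis[where 'a='a] by (metis empty_iff mem_sphere_0)
  moreover have "continuous_on (sphere 0 1) (\<lambda>v. norm (f v))"
    by (intro continuous_intros linear_continuous_on assms)
  ultimately obtain d where d: "d \<in> sphere 0 1" "\<And>w. w \<in> sphere 0 1 \<Longrightarrow> norm (f w) \<le> norm (f d)"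
    using continuous_attains_sup[OF compact_sphere] by metis
  have "norm (f w) \<le> norm (f d) * norm w" for w
  proof (cases "w = 0")
    case False
    with d(2)[of "w /\<^sub>R norm w"] show ?thesis
      by (simp add: linear_scale[OF lin] field_simps)
  qed (simp add: linear_0[OF lin])
  then have "onorm f \<le> norm (f d)" by (rule onorm_le)
  moreover have "norm (f d) \<le> onorm f" using onorm[OF assms, of d] d(1) by simp
  moreover have "norm d = 1" using d(1) by simp
  moreover from this have "d \<noteq> 0" by auto
  ultimately show ?thesis by (intro that[of d]) auto
qed

text \<open>The squared norm of \<open>f x\<close> equals \<open>x \<bullet> g (f x)\<close>;
  Cauchy-Schwarz bounds it through \<open>onorm g\<close>, and the situation is symmetric in
  \<open>f\<close> and \<open>g\<close>.\<close>

lemma onorm_adjoint_eq: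
  fixes f :: "'a::real_inner \<Rightarrow> 'b::real_inner"
  assumes "bounded_linear f" "bounded_linear g" "\<And>x y. f x \<bullet> y = x \<bullet> g y"
  shows "onorm f = onorm g"
proof -
  have le: "onorm f \<le> onorm g"
    if "bounded_linear g" "\<And>x y. f x \<bullet> y = x \<bullet> g y"
    for f :: "'c::real_inner \<Rightarrow> 'd::real_inner" and g
  proof (rule onorm_bound[OF onorm_pos_le[OF that(1)]])
    fix x
    have "(norm (f x))\<^sup>2 \<le> norm x * norm (g (f x))"
      by (simp add: power2_norm_eq_inner that(2) norm_cauchy_schwarz)
    also have "\<dots> \<le> norm x * (onorm g * norm (f x))"
      by (intro mult_left_mono onorm[OF that(1)]) simp
    finally show "norm (f x) \<le> onorm g * norm x"
      using onorm_pos_le[OF that(1)] by (cases "f x = 0") (auto simp: power2_eq_square mult_ac)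
  qed
  show ?thesis
    using le[OF assms(2,3)] le[OF assms(1), of g] assms(3) by (metis antisym inner_commute)
qed

lemma onorm_eq_scale:
  assumes "bounded_linear g" "0 \<le> c" "\<And>x. norm (f x) = c * norm (g x)"
  shows "onorm f = c * onorm g"
proof -
  have "onorm f = onorm (\<lambda>x. c *\<^sub>R g x)"
    unfolding onorm_def using assms(2,3) by simp
  then show ?thesis using onorm_scaleR[OF assms(1), of c] assms(2) by simp
qed

lemma onorm_matrix_transpose: "onorm ((*v) (transpose M)) = onorm ((*v) (M :: real^'c^'r))"
  by (rule onorm_adjoint_eq) (auto simp: inner_transpose_mult)

lemma spectral_norm_orthonormal_mult:
  fixes U :: "real^'c^'r"
  assumes "transpose U ** U = mat 1"
  shows "spectral_norm (U ** M) = spectral_norm M"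
  unfolding spectral_norm_def onorm_def
  by (simp add: matrix_vector_mul_assoc[symmetric] norm_orthonormal_mult[OF assms])

lemma tls_cond_eq_onorm:
  fixes A :: "real^'n^'m"
  assumes "(tls_map L has_derivative f) (at (A, b))"
  shows "tls_cond L A b = onorm f"
proof -
  have f: "bounded_linear f" using assms by (rule has_derivative_bounded_linear)
  obtain d where d: "d \<noteq> 0" "norm (f d) / norm d = onorm f"
    using onorm_attained[OF f] .
  show ?thesis
    unfolding tls_cond_def frechet_derivative_at[OF assms, symmetric]
  proof (rule Greatest_equality)
    show "\<exists>d. d \<noteq> 0 \<and> onorm f = norm (f d) / norm d" using d by metis
    show "r \<le> onorm f" if "\<exists>d. d \<noteq> 0 \<and> r = norm (f d) / norm d" for r
      using that le_onorm[OF f] by blast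
  qed
qed

section \<open>The derivative and the norm of its adjoint\<close>

definition tls_derivative :: "real^'n^'m \<Rightarrow> real^'m \<Rightarrow> real^'n \<Rightarrow> (real^'n^'m) \<times> (real^'m) \<Rightarrow> real^'n" where
  "tls_derivative A b x d =
     (2 * ((A *v x - b) \<bullet> (fst d *v x - snd d)) / (1 + x \<bullet> x)) *\<^sub>R x
       - (transpose (fst d) *v (A *v x - b) + transpose A *v (fst d *v x - snd d))"

definition tls_adjoint :: "real^'n^'m \<Rightarrow> real^'m \<Rightarrow> real^'n \<Rightarrow> real^'n \<Rightarrow> (real^'n^'m) \<times> (real^'m)" where
  "tls_adjoint A b x u =
     (let r = A *v x - b; z = A *v u - (2 * (x \<bullet> u) / (1 + x \<bullet> x)) *\<^sub>R r
      in (- outer_prod r u - outer_prod z x, z))"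

lemma tls_derivative_adjoint:
  "tls_derivative A b x d \<bullet> u = d \<bullet> tls_adjoint A b x u"
proof -
  define r where "r = A *v x - b"
  define e where "e = fst d *v x - snd d"
  define c where "c = 2 * (x \<bullet> u) / (1 + x \<bullet> x)"
  define z where "z = A *v u - c *\<^sub>R r"
  have "tls_derivative A b x d \<bullet> u = c * (r \<bullet> e) - (r \<bullet> (fst d *v u) + e \<bullet> (A *v u))"
    unfolding tls_derivative_def r_def[symmetric] e_def[symmetric]
    by (simp add: inner_diff_left inner_add_left inner_transpose_mult c_def)
  also have "\<dots> = - (r \<bullet> (fst d *v u)) - z \<bullet> e"
    by (simp add: z_def inner_diff_left inner_commute[of e])
  also have "\<dots> = d \<bullet> (- outer_prod r u - outer_prod z x, z)"
    by (simp add: inner_prod_def inner_diff_right inner_outer_prod e_def inner_commute[of z "snd d"])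
  finally show ?thesis
    unfolding tls_adjoint_def Let_def r_def[symmetric] c_def[symmetric] z_def[symmetric] .
qed

lemma linear_tls_adjoint: "linear (tls_adjoint A b x)"
proof (rule linearI)
  show "tls_adjoint A b x (u + v) = tls_adjoint A b x u + tls_adjoint A b x v" for u v
    by (simp add: tls_adjoint_def outer_prod_def vec_eq_iff add_divide_distrib algebra_simps inner_add_right)
  show "tls_adjoint A b x (c *\<^sub>R u) = c *\<^sub>R tls_adjoint A b x u" for c u
    by (simp add: tls_adjoint_def outer_prod_def vec_eq_iff algebra_simps)
qed

text \<open>If \<open>r\<close> is nonzero, then
  \<open>c = 2 (r \<bullet> A u) / (r \<bullet> r)\<close>, so \<open>z\<close> is the reflection of
  \<open>A u\<close> in the hyperplane orthogonal to \<open>r\<close>; if \<open>r = 0\<close>, then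
  \<open>z = A u\<close>. This explains why \<open>z\<close> has the norm of \<open>A u\<close> and
  why \<open>r \<bullet> z\<close> is the negative of \<open>r \<bullet> A u\<close>.\<close>

lemma norm_tls_adjoint:
  assumes "tls_point A b x"
  shows "(norm (tls_adjoint A b x u))\<^sup>2 = (1 + (norm x)\<^sup>2) *
    ((norm (A *v u))\<^sup>2 + tls_value A b * (norm u)\<^sup>2 - 2 * tls_value A b * (x \<bullet> u)\<^sup>2 / (1 + (norm x)\<^sup>2))"
proof -
  define r where "r = A *v x - b"
  define \<beta> where "\<beta> = 1 + x \<bullet> x"
  define c where "c = 2 * (x \<bullet> u) / \<beta>"
  define l where "l = tls_value A b"
  define z where "z = A *v u - c *\<^sub>R r"
  have \<beta>: "\<beta> > 0" unfolding \<beta>_def by (smt (verit) inner_ge_zero)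
  have cb: "c * \<beta> = 2 * (x \<bullet> u)" using \<beta> by (simp add: c_def)
  have rr: "r \<bullet> r = l * \<beta>"
    using assms by (simp add: tls_point_def r_def l_def \<beta>_def power2_norm_eq_inner)
  have rA: "r \<bullet> (A *v u) = l * (x \<bullet> u)"
    using tls_point_stationary[OF assms, of u 0] by (simp add: r_def l_def)
  have rz: "r \<bullet> z = - l * (x \<bullet> u)"
  proof -
    have "r \<bullet> z = l * (x \<bullet> u) - l * (c * \<beta>)"
      by (simp add: z_def inner_diff_right rr rA)
    then show ?thesis by (simp add: cb)
  qed
  have zz: "z \<bullet> z = (A *v u) \<bullet> (A *v u)"
  proof -
    have "z \<bullet> z = (A *v u) \<bullet> (A *v u) - 2 * c * (l * (x \<bullet> u)) + c * l * (c * \<beta>)"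
      by (simp add: z_def inner_diff_right inner_diff_left rr rA inner_commute[of "A *v u" r]
          algebra_simps)
    then show ?thesis unfolding cb by simp
  qed
  have neg: "(- P - Q) \<bullet> (- P - Q) = (P + Q) \<bullet> (P + Q)" for P Q :: "real^'a^'b"
    by (simp add: inner_diff_left inner_diff_right inner_add_left inner_add_right)
  have "(norm (tls_adjoint A b x u))\<^sup>2 =
      (- outer_prod r u - outer_prod z x) \<bullet> (- outer_prod r u - outer_prod z x) + z \<bullet> z"
    by (simp add: tls_adjoint_def Let_def power2_norm_eq_inner r_def z_def c_def \<beta>_def)
  also have "\<dots> = (r \<bullet> r) * (u \<bullet> u) + 2 * (r \<bullet> z) * (x \<bullet> u) + \<beta> * (z \<bullet> z)"
    unfolding neg
    by (simp add: inner_add_left inner_add_right inner_outer_prod outer_prod_mult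
        matrix_vector_mult_add_rdistrib \<beta>_def inner_commute[of z r] inner_commute[of u x] algebra_simps)
  also have "\<dots> = \<beta> * ((A *v u) \<bullet> (A *v u) + l * (u \<bullet> u) - 2 * l * (x \<bullet> u)\<^sup>2 / \<beta>)"
    using \<beta> by (simp add: rr rz zz field_simps power2_eq_square)
  finally show ?thesis by (simp add: \<beta>_def l_def power2_norm_eq_inner)
qed

text \<open>The hypothesis on \<open>M\<close> says that \<open>M M\<^sup>T\<close> is
  \<open>A\<^sup>T A + \<lambda> I - 2 \<lambda> x x\<^sup>T / (1 +
  \<parallel>x\<parallel>\<^sup>2)\<close>, the quadratic form found for the adjoint. Passing to the
  adjoint turns the maximum over data increments into one over vectors \<open>u\<close>.\<close>

lemma tls_cond_eq_spectral_norm: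
  fixes A :: "real^'n^'m" and L :: "real^'k^'n"
  assumes gen: "tls_generic A b" and x: "x = tls_solution A b"
    and R: "\<And>y. R *v (transpose A *v (A *v y) - tls_value A b *\<^sub>R y) = y" "transpose R = R"
    and M: "\<And>u. (norm (transpose M *v u))\<^sup>2 =
      (norm (A *v u))\<^sup>2 + tls_value A b * (norm u)\<^sup>2 - 2 * tls_value A b * (x \<bullet> u)\<^sup>2 / (1 + (norm x)\<^sup>2)"
  shows "tls_cond L A b = sqrt (1 + (norm x)\<^sup>2) * spectral_norm (transpose L ** R ** M)"
proof -
  let ?f = "\<lambda>d. transpose L *v (R *v tls_derivative A b x d)"
  let ?g = "\<lambda>u. tls_adjoint A b x (R *v (L *v u))"
  have "((\<lambda>p. tls_solution (fst p) (snd p)) has_derivative (\<lambda>d. R *v tls_derivative A b x d)) (at (A, b))"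
    unfolding tls_derivative_def by (rule has_derivative_tls_solution[OF gen x R(1)])
  then have f: "(tls_map L has_derivative ?f) (at (A, b))"
    unfolding tls_map_def case_prod_unfold
    by (rule bounded_linear.has_derivative[OF matrix_vector_mul_bounded_linear])
  have g: "bounded_linear ?g"
    using linear_compose[OF linear_compose[OF matrix_vector_mul_linear matrix_vector_mul_linear]
        linear_tls_adjoint]
    by (simp add: linear_conv_bounded_linear o_def)
  have "?f d \<bullet> u = d \<bullet> ?g u" for d u
    by (metis R(2) inner_transpose_mult tls_derivative_adjoint)
  then have "tls_cond L A b = onorm ?g"
    unfolding tls_cond_eq_onorm[OF f]
    by (intro onorm_adjoint_eq g has_derivative_bounded_linear[OF f])
  also have "\<dots> = sqrt (1 + (norm x)\<^sup>2) * onorm ((*v) (transpose (transpose L ** R ** M)))"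
  proof (rule onorm_eq_scale)
    fix u
    have "tls_point A b x" unfolding x by (rule tls_point_tls_solution[OF gen])
    then have "(norm (?g u))\<^sup>2 = (1 + (norm x)\<^sup>2) * (norm (transpose M *v (R *v (L *v u))))\<^sup>2"
      by (simp only: norm_tls_adjoint M)
    then have "norm (?g u) = sqrt ((1 + (norm x)\<^sup>2) * (norm (transpose M *v (R *v (L *v u))))\<^sup>2)"
      by (metis norm_ge_zero real_sqrt_unique)
    then show "norm (?g u) = sqrt (1 + (norm x)\<^sup>2) * norm (transpose (transpose L ** R ** M) *v u)"
      by (simp add: real_sqrt_mult matrix_transpose_mul R(2) matrix_vector_mul_assoc matrix_mul_assoc)
  qed auto
  finally show ?thesis
    unfolding spectral_norm_def onorm_matrix_transpose .
qed

section \<open>Singular value decompositions\<close>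

lemma orthogonal_matrix_mult_transpose:
  assumes "orthogonal_matrix V"
  shows "V *v (transpose V *v y) = y" "transpose V *v (V *v y) = y"
  using assms by (simp_all add: orthogonal_matrix_def matrix_vector_mul_assoc)

lemma thin_svd_norm_sq:
  assumes "thin_svd M U s V"
  shows "(norm (M *v y))\<^sup>2 = (\<Sum>j\<in>UNIV. (s j)\<^sup>2 * ((transpose V *v y) $ j)\<^sup>2)"
proof -
  have "M *v y = U *v (diag_mat s *v (transpose V *v y))"
    using assms by (simp add: thin_svd_def matrix_vector_mul_assoc matrix_mul_assoc)
  then have "norm (M *v y) = norm (diag_mat s *v (transpose V *v y))"
    using assms by (simp add: thin_svd_def norm_orthonormal_mult)
  then show ?thesis by (simp add: norm_vec_sq diag_mat_mult power_mult_distrib)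
qed

lemma thin_svd_gram:
  assumes "thin_svd M U s V"
  shows "transpose M *v (M *v y) = V *v (diag_mat (\<lambda>j. (s j)\<^sup>2) *v (transpose V *v y))"
proof -
  have M: "M = U ** diag_mat s ** transpose V" and U: "transpose U ** U = mat 1"
    using assms by (simp_all add: thin_svd_def)
  have "transpose M *v (M *v y)
      = V *v (diag_mat s *v ((transpose U ** U) *v (diag_mat s *v (transpose V *v y))))"
    unfolding M by (simp add: matrix_transpose_mul transpose_diag_mat matrix_vector_mul_assoc matrix_mul_assoc)
  also have "diag_mat s *v ((transpose U ** U) *v (diag_mat s *v (transpose V *v y)))
      = diag_mat (\<lambda>j. (s j)\<^sup>2) *v (transpose V *v y)"
    by (simp add: U vec_eq_iff diag_mat_mult power2_eq_square)
  finally show ?thesis .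
qed

lemma norm_transpose_orthogonal:
  assumes "orthogonal_matrix V"
  shows "norm (transpose V *v y) = norm (y :: real^'n)"
  using assms by (intro norm_orthonormal_mult) (simp add: orthogonal_matrix_def)

lemma thin_svd_norm_column:
  assumes "thin_svd M U s V"
  shows "norm (M *v (V *v axis i 1)) = s i" "norm (V *v axis i 1) = 1"
proof -
  have V: "orthogonal_matrix V" and s: "0 \<le> s i" using assms by (auto simp: thin_svd_def)
  have "(norm (M *v (V *v axis i 1)))\<^sup>2 = (\<Sum>j\<in>UNIV. (s j)\<^sup>2 * (axis i 1 $ j)\<^sup>2)"
    unfolding thin_svd_norm_sq[OF assms] orthogonal_matrix_mult_transpose[OF V] ..
  also have "\<dots> = (\<Sum>j\<in>UNIV. if j = i then (s j)\<^sup>2 else 0)"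
    by (rule sum.cong) (auto simp: axis_def)
  finally show "norm (M *v (V *v axis i 1)) = s i" using s by (simp add: power2_eq_iff_nonneg)
  show "norm (V *v axis i 1) = 1"
    using V by (simp add: norm_orthonormal_mult orthogonal_matrix_def)
qed

lemma smin_thin_svd:
  assumes "thin_svd M U s V" "\<And>j. s i \<le> s j"
  shows "smin M = s i"
proof (rule antisym)
  show "smin M \<le> s i"
    using smin_le[of M "V *v axis i 1"] thin_svd_norm_column[OF assms(1), of i] by simp
  show "s i \<le> smin M"
  proof (rule smin_geI)
    fix v :: "real^'a" assume v: "norm v = 1"
    have V: "orthogonal_matrix V" and s: "0 \<le> s i" for i using assms by (auto simp: thin_svd_def)
    have "(s i)\<^sup>2 = (s i)\<^sup>2 * (norm (transpose V *v v))\<^sup>2"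
      by (simp add: norm_transpose_orthogonal[OF V] v)
    also have "\<dots> = (\<Sum>j\<in>UNIV. (s i)\<^sup>2 * ((transpose V *v v) $ j)\<^sup>2)"
      by (simp add: norm_vec_sq sum_distrib_left)
    also have "\<dots> \<le> (norm (M *v v))\<^sup>2"
      unfolding thin_svd_norm_sq[OF assms(1)]
      by (intro sum_mono mult_right_mono power_mono assms(2) s) auto
    finally show "s i \<le> norm (M *v v)" by (rule power2_le_imp_le) simp
  qed
qed

text \<open>In the coordinates of \<open>V\<close> the shifted Gram matrix is diagonal; for
  \<open>A\<close> and the minimal value this is the \<open>R\<close> of the derivative.\<close>

lemma thin_svd_shifted_inverse:
  assumes "thin_svd M U s V" "\<And>i. (s i)\<^sup>2 \<noteq> l"
  shows "(V ** diag_mat (\<lambda>i. inverse ((s i)\<^sup>2 - l)) ** transpose V) *v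
    (transpose M *v (M *v y) - l *\<^sub>R y) = y"
proof -
  have V: "orthogonal_matrix V" using assms by (simp add: thin_svd_def)
  define q where "q = transpose V *v y"
  have y: "y = V *v q" by (simp add: q_def orthogonal_matrix_mult_transpose[OF V])
  have "transpose V *v (transpose M *v (M *v y) - l *\<^sub>R y) = diag_mat (\<lambda>j. (s j)\<^sup>2) *v q - l *\<^sub>R q"
    unfolding thin_svd_gram[OF assms(1)]
    by (simp add: matrix_vector_mult_diff_distrib matrix_vector_mult_scaleR
        orthogonal_matrix_mult_transpose[OF V] flip: q_def)
  moreover have "diag_mat (\<lambda>i. inverse ((s i)\<^sup>2 - l)) *v (diag_mat (\<lambda>j. (s j)\<^sup>2) *v q - l *\<^sub>R q) = q"
    using assms(2) by (simp add: vec_eq_iff diag_mat_mult left_diff_distrib[symmetric])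
  ultimately show ?thesis
    by (simp add: matrix_vector_mul_assoc[symmetric] flip: y)
qed

text \<open>In the coordinates \<open>q\<close> of \<open>(u, 0)\<close> with respect to
  \<open>V\<close>, the first two terms on the right form the sum of
  \<open>((s j)\<^sup>2 + (s None)\<^sup>2) (q j)\<^sup>2\<close> over all \<open>n + 1\<close>
  indices. The matrix \<open>[D, 0]\<close> drops the index \<open>None\<close>, and the last term
  accounts for it.\<close>

lemma thin_svd_projected_norm:
  fixes A :: "real^'n^'m" and d :: "'n \<Rightarrow> real"
  assumes svd: "thin_svd (append_col A b) U s V" and gen: "tls_generic A b"
    and min: "\<And>i. s None \<le> s (Some i)" and x: "x = tls_solution A b"
  defines "M \<equiv> append_col (mat 1) 0 ** V **
    transpose (append_col (diag_mat (\<lambda>i. sqrt ((s (Some i))\<^sup>2 + (s None)\<^sup>2))) 0)"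
  shows "(norm (transpose M *v u))\<^sup>2 =
    (norm (A *v u))\<^sup>2 + (s None)\<^sup>2 * (norm u)\<^sup>2 - 2 * (s None)\<^sup>2 * (x \<bullet> u)\<^sup>2 / (1 + (norm x)\<^sup>2)"
proof -
  have V: "orthogonal_matrix V" using svd by (simp add: thin_svd_def)
  have smin: "smin (append_col A b) = s None"
    by (rule smin_thin_svd[OF svd]) (metis min not_None_eq order_refl)
  define v where "v = V *v axis None 1"
  have v: "norm v = 1" "norm (append_col A b *v v) = smin (append_col A b) * norm v"
    using thin_svd_norm_column[OF svd, of None] by (simp_all add: v_def smin)
  obtain y t where y: "v = t *\<^sub>R vec_snoc y (-1)" "tls_point A b y"
    using v(1) by (auto intro: smin_vector_snoc[OF gen v(2)])
  have yx: "y = x"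
    unfolding x by (rule tls_point_unique[OF gen y(2) tls_point_tls_solution[OF gen]])
  \<comment> \<open>The scaling factor follows from the unit length of the last column of
    \<open>V\<close>.\<close>
  have t: "t\<^sup>2 * (1 + (norm x)\<^sup>2) = 1"
  proof -
    have "(norm v)\<^sup>2 = t\<^sup>2 * (norm (vec_snoc x (-1)))\<^sup>2"
      by (simp add: y(1) yx power_mult_distrib)
    then show ?thesis by (simp add: v(1) norm_vec_snoc_sq add.commute)
  qed
  define w where "w = vec_snoc u 0"
  define q where "q = transpose V *v w"
  have "append_col A b *v w = A *v u" by (simp add: w_def append_col_mult)
  then have Au: "(norm (A *v u))\<^sup>2 = (\<Sum>j\<in>UNIV. (s j)\<^sup>2 * (q $ j)\<^sup>2)"
    using thin_svd_norm_sq[OF svd, of w] by (simp add: q_def)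
  have "norm q = norm w" unfolding q_def by (rule norm_transpose_orthogonal[OF V])
  then have un: "(norm u)\<^sup>2 = (\<Sum>j\<in>UNIV. (q $ j)\<^sup>2)"
    using norm_vec_snoc_sq[of u 0] by (simp add: w_def norm_vec_sq[of q, symmetric])
  have "q $ None = v \<bullet> w"
    unfolding q_def v_def inner_transpose_mult_right[symmetric] by (simp add: inner_axis')
  also have "\<dots> = t * (x \<bullet> u)" by (simp add: y(1) yx w_def inner_vec_snoc)
  finally have "(q $ None)\<^sup>2 = t\<^sup>2 * (x \<bullet> u)\<^sup>2" by (simp add: power_mult_distrib)
  moreover have "t\<^sup>2 = 1 / (1 + (norm x)\<^sup>2)"
    using t by (metis mult_zero_right nonzero_eq_divide_eq zero_neq_one)
  ultimately have qN: "(q $ None)\<^sup>2 = (x \<bullet> u)\<^sup>2 / (1 + (norm x)\<^sup>2)" by simp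
  let ?D = "diag_mat (\<lambda>i. sqrt ((s (Some i))\<^sup>2 + (s None)\<^sup>2))"
  obtain p c where p: "q = vec_snoc p c" by (rule vec_snoc_cases)
  have "transpose M *v u = append_col ?D 0 *v q"
    unfolding M_def q_def w_def
    by (simp add: matrix_transpose_mul transpose_append_col_mult flip: matrix_vector_mul_assoc)
  also have "\<dots> = ?D *v p" by (simp add: p append_col_mult)
  finally have "(norm (transpose M *v u))\<^sup>2 = (\<Sum>i\<in>UNIV. ((s (Some i))\<^sup>2 + (s None)\<^sup>2) * (p $ i)\<^sup>2)"
    by (simp add: norm_vec_sq diag_mat_mult power_mult_distrib)
  also have "\<dots> = (\<Sum>i\<in>UNIV. ((s (Some i))\<^sup>2 + (s None)\<^sup>2) * (q $ Some i)\<^sup>2)"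
    by (simp add: p vec_snoc_def)
  \<comment> \<open>At \<open>None\<close> the weight is twice \<open>(s None)\<^sup>2\<close>,
    hence the factor 2 in the subtracted term.\<close>
  also have "\<dots> = (\<Sum>j\<in>UNIV. ((s j)\<^sup>2 + (s None)\<^sup>2) * (q $ j)\<^sup>2) - 2 * (s None)\<^sup>2 * (q $ None)\<^sup>2"
    by (simp add: sum_option)
  also have "\<dots> = (norm (A *v u))\<^sup>2 + (s None)\<^sup>2 * (norm u)\<^sup>2 - 2 * (s None)\<^sup>2 * (q $ None)\<^sup>2"
    unfolding Au un by (simp add: sum.distrib sum_distrib_left distrib_right)
  finally show ?thesis by (simp add: qN)
qed

section \<open>The condition number formula\<close>

theorem theorem2:
  fixes A :: "real^('n::{finite,linorder})^'m"
    and b :: "real^'m"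
    and L :: "real^'k^('n::{finite,linorder})"
    and \<sigma> :: "'n option \<Rightarrow> real" and V :: "real^('n option)^('n option)"
    and \<sigma>' :: "'n \<Rightarrow> real" and V' :: "real^('n::{finite,linorder})^('n::{finite,linorder})"
    and x :: "real^('n::{finite,linorder})" and D D' :: "real^('n::{finite,linorder})^('n::{finite,linorder})"
  assumes "CARD('m) > CARD('n)"
    and "CARD('k) \<le> CARD('n)"
    and "right_singular_system (append_col A b) \<sigma> V"
    and "\<And>i j. i \<le> j \<Longrightarrow> \<sigma> (Some i) \<ge> \<sigma> (Some j)"
    and "\<And>i. \<sigma> (Some i) \<ge> \<sigma> None"
    and "right_singular_system A \<sigma>' V'"
    and "\<And>i j. i \<le> j \<Longrightarrow> \<sigma>' i \<ge> \<sigma>' j"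
    and "\<sigma>' (Max UNIV) > \<sigma> None"
    and "x = tls_solution A b"
    and "D' = diag_mat (\<lambda>i. inverse ((\<sigma>' i)\<^sup>2 - (\<sigma> None)\<^sup>2))"
    and "D = diag_mat (\<lambda>i. sqrt ((\<sigma> (Some i))\<^sup>2 + (\<sigma> None)\<^sup>2))"
  shows "tls_cond L A b =
           sqrt (1 + (norm x)\<^sup>2) *
           spectral_norm (transpose L ** V' ** D' ** append_col (transpose V') 0 ** V **
             transpose (append_col D 0)) \<and>
         tls_cond (mat 1 :: real^('n::{finite,linorder})^('n::{finite,linorder})) A b =
           sqrt (1 + (norm x)\<^sup>2) *
           spectral_norm (D' ** append_col (transpose V') 0 ** V ** transpose (append_col D 0))"
proof -
  obtain U U' where svd: "thin_svd (append_col A b) U \<sigma> V" and svd': "thin_svd A U' \<sigma>' V'"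
    using assms(3,6) unfolding right_singular_system_def by blast
  have smin: "smin (append_col A b) = \<sigma> None"
    by (rule smin_thin_svd[OF svd]) (metis assms(5) not_None_eq order_refl)
  \<comment> \<open>The values \<open>\<sigma>'\<close> decrease along the index order, so the
    largest index carries the smallest one.\<close>
  have smin': "smin A = \<sigma>' (Max UNIV)"
    by (rule smin_thin_svd[OF svd']) (simp add: assms(7))
  have gen: "tls_generic A b"
    using assms(8) by (simp add: tls_generic_def smin smin')
  have val: "tls_value A b = (\<sigma> None)\<^sup>2" by (simp add: tls_value_def smin)
  \<comment> \<open>Genericity makes the entries of \<open>D'\<close> true reciprocals rather than
    the default \<open>inverse 0 = 0\<close>.\<close>
  have "(\<sigma>' i)\<^sup>2 \<noteq> (\<sigma> None)\<^sup>2" for i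
  proof -
    have "\<sigma> None < \<sigma>' i" using assms(7)[of i "Max UNIV"] assms(8) by simp
    moreover have "0 \<le> \<sigma> None" using smin_nonneg[of "append_col A b"] by (simp add: smin)
    ultimately show ?thesis by (simp add: power2_eq_iff_nonneg)
  qed
  note R = thin_svd_shifted_inverse[OF svd' this, folded assms(10) val]
  have symm: "transpose (V' ** D' ** transpose V') = V' ** D' ** transpose V'"
    by (simp add: assms(10) matrix_transpose_mul transpose_diag_mat matrix_mul_assoc)
  define M where "M = append_col (mat 1) 0 ** V ** transpose (append_col D 0)"
  note cond = tls_cond_eq_spectral_norm[OF gen assms(9) R symm
      thin_svd_projected_norm[OF svd gen assms(5,9), folded assms(11) val M_def]]
  \<comment> \<open>The projection \<open>[I, 0]\<close> in \<open>M\<close> is absorbed into the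
    factor \<open>V'\<^sup>T\<close> of the inverse.\<close>
  have col: "transpose V' ** append_col (mat 1) 0 = append_col (transpose V') 0"
    by (simp add: matrix_mult_append_col)
  have shape: "N ** (V' ** D' ** transpose V') ** M
      = N ** V' ** D' ** append_col (transpose V') 0 ** V ** transpose (append_col D 0)"
    for N :: "real^('n::{finite,linorder})^'c"
    unfolding M_def col[symmetric] by (simp add: matrix_mul_assoc)
  \<comment> \<open>For \<open>L = I\<close> the leading orthogonal factor \<open>V'\<close> leaves
    the spectral norm unchanged, which gives the reduced formula.\<close>
  have "transpose V' ** V' = mat 1"
    using svd' by (simp add: thin_svd_def orthogonal_matrix_def)
  from spectral_norm_orthonormal_mult[OF this]
  have "spectral_norm (V' ** D' ** append_col (transpose V') 0 ** V ** transpose (append_col D 0))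
      = spectral_norm (D' ** append_col (transpose V') 0 ** V ** transpose (append_col D 0))"
    by (simp add: matrix_mul_assoc[symmetric])
  moreover have "tls_cond (mat 1 :: real^('n::{finite,linorder})^('n::{finite,linorder})) A b = sqrt (1 + (norm x)\<^sup>2) *
      spectral_norm (V' ** D' ** append_col (transpose V') 0 ** V ** transpose (append_col D 0))"
    using cond[of "mat 1"] unfolding shape by simp
  ultimately show ?thesis
    using cond[of L] unfolding shape by simp
qed

end
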